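(* Let $G$ be a perfect graph with $\alpha=\alpha(G)$ and $\omega=\omega(G)$. Then $$s_{\lceil(\omega\alpha-1)/(\omega+1)\rceil}\geq\cdots\geq s_{\alpha-1}\geq s_{\alpha},$$ i.e. $s_k\geq s_{k+1}$ for every integer $k$ with $\lceil(\omega\alpha-1)/(\omega+1)\rceil\leq k<\alpha$.
   Context: All graphs are finite, undirected, without loops or multiple edges. A stable set is a set of pairwise non-adjacent vertices (the empty set is stable). The stability number $\alpha(G)$ is the maximum cardinality of a stable set in $G$, $\omega(G)=\alpha(\overline{G})$ is the clique number ($\overline{G}$ being the complement of $G$), and $s_k$ denotes the number of stable sets of cardinality $k$ in $G$, for $0\leq k\leq\alpha(G)$. A graph $G$ is perfect if $\chi(H)=\omega(H)$ for every induced subgraph $H$ of $G$, where $\chi(H)$ is the chromatic number of $H$. *)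

theory Defs
  imports Complex_Main "Graph_Theory.Graph_Theory"
begin

text \<open>
  A finite simple undirected graph is rendered by the locale predicate \<^const>\<open>graph\<close> of
  \<^theory>\<open>Graph_Theory.Digraph\<close>: a finite symmetric digraph without loops and without parallel
  arcs. Two vertices are adjacent iff they are related by \<^const>\<open>arcs_ends\<close>; the null graph is
  allowed.
\<close>

definition stable_set :: "('a, 'b) pre_digraph \<Rightarrow> 'a set \<Rightarrow> bool" where
  "stable_set G S \<longleftrightarrow> S \<subseteq> verts G \<and> pairwise (\<lambda>u v. \<not> u \<rightarrow>\<^bsub>G\<^esub> v) S"

definition stability_number :: "('a, 'b) pre_digraph \<Rightarrow> nat" where
  "stability_number G = Max (card ` {S. stable_set G S})"

definition num_stable_sets :: "('a, 'b) pre_digraph \<Rightarrow> nat \<Rightarrow> nat" where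
  "num_stable_sets G k = card {S. stable_set G S \<and> card S = k}"

definition complement_graph :: "('a, 'b) pre_digraph \<Rightarrow> ('a, 'a \<times> 'a) pre_digraph" where
  "complement_graph G = with_proj
     \<lparr> pverts = verts G,
       parcs = {(u, v). u \<in> verts G \<and> v \<in> verts G \<and> u \<noteq> v \<and> \<not> u \<rightarrow>\<^bsub>G\<^esub> v} \<rparr>"

definition clique_number :: "('a, 'b) pre_digraph \<Rightarrow> nat" where
  "clique_number G = stability_number (complement_graph G)"

definition proper_coloring :: "('a, 'b) pre_digraph \<Rightarrow> nat \<Rightarrow> ('a \<Rightarrow> nat) \<Rightarrow> bool" where
  "proper_coloring G k c \<longleftrightarrow>
     c ` verts G \<subseteq> {..<k} \<and> (\<forall>u v. u \<rightarrow>\<^bsub>G\<^esub> v \<longrightarrow> c u \<noteq> c v)"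

definition chromatic_number :: "('a, 'b) pre_digraph \<Rightarrow> nat" where
  "chromatic_number G = (LEAST k. \<exists>c. proper_coloring G k c)"

definition perfect :: "('a, 'b) pre_digraph \<Rightarrow> bool" where
  "perfect G \<longleftrightarrow> (\<forall>H. induced_subgraph H G \<longrightarrow> chromatic_number H = clique_number H)"

end

theory Submission
  imports Defs
begin

text \<open>
  Double counting the pairs \<open>S \<subset> T\<close> of stable sets with \<open>card S = k\<close> and \<open>card T = k + 1\<close>. Each
  \<open>T\<close> contains \<open>k + 1\<close> such \<open>S\<close>. The extensions of a given \<open>S\<close> correspond to the vertices of the
  subgraph \<open>H\<close> induced on the common non-neighbours of \<open>S\<close>. As \<open>H\<close> is properly coloured with
  \<open>\<omega>(H) \<le> \<omega>\<close> colours and its stable sets can be added to \<open>S\<close>, it has at most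
  \<open>\<omega>(H) \<alpha>(H) \<le> \<omega> (\<alpha> - k)\<close> vertices. Hence \<open>(k + 1) s\<^bsub>k+1\<^esub> \<le> \<omega> (\<alpha> - k) s\<^bsub>k\<^esub>\<close>, and the lower
  bound on \<open>k\<close> says precisely that \<open>\<omega> (\<alpha> - k) \<le> k + 1\<close>.
\<close>

lemma stable_set_subset: "stable_set G T \<Longrightarrow> S \<subseteq> T \<Longrightarrow> stable_set G S"
  unfolding stable_set_def by (auto intro: pairwise_subset)

lemma finite_stable_sets: "finite (verts G) \<Longrightarrow> finite {S. stable_set G S}"
  by (rule finite_subset[of _ "Pow (verts G)"]) (auto simp: stable_set_def)

lemma card_stable_set_le:
  assumes "finite (verts G)" "stable_set G S"
  shows "card S \<le> stability_number G"
  unfolding stability_number_def using assms finite_stable_sets[of G] by (intro Max_ge) auto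

lemma stability_number_le:
  assumes "finite (verts G)" "\<And>S. stable_set G S \<Longrightarrow> card S \<le> m"
  shows "stability_number G \<le> m"
proof -
  \<comment> \<open>The empty set makes the family nonempty, as required for bounding its
    \<open>Max\<close>.\<close>
  have "stable_set G {}"
    by (simp add: stable_set_def)
  then show ?thesis
    unfolding stability_number_def using assms finite_stable_sets[of G] by (subst Max_le_iff) auto
qed

lemma verts_complement_graph [simp]: "verts (complement_graph G) = verts G"
  by (simp add: complement_graph_def)

lemma dominates_complement_graph [simp]:
  "u \<rightarrow>\<^bsub>complement_graph G\<^esub> v \<longleftrightarrow> u \<in> verts G \<and> v \<in> verts G \<and> u \<noteq> v \<and> \<not> u \<rightarrow>\<^bsub>G\<^esub> v"
  by (simp add: complement_graph_def)

lemma dominates_induce_subgraph [simp]: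
  "u \<rightarrow>\<^bsub>G \<restriction> W\<^esub> v \<longleftrightarrow> u \<in> W \<and> v \<in> W \<and> u \<rightarrow>\<^bsub>G\<^esub> v"
  by (auto simp: arcs_ends_conv)

text \<open>Inside \<open>W\<close> the induced subgraph and \<open>G\<close> have the same
  adjacencies, so a clique of the former is a clique of \<open>G\<close>.\<close>

lemma clique_number_induce_subgraph_le:
  assumes "finite (verts G)" "W \<subseteq> verts G"
  shows "clique_number (G \<restriction> W) \<le> clique_number G"
  unfolding clique_number_def
proof (rule stability_number_le)
  show "finite (verts (complement_graph (G \<restriction> W)))"
    using assms finite_subset by auto
  fix S assume "stable_set (complement_graph (G \<restriction> W)) S"
  then have "stable_set (complement_graph G) S"
    using assms(2) by (fastforce simp: stable_set_def pairwise_def)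
  with assms(1) show "card S \<le> stability_number (complement_graph G)"
    by (simp add: card_stable_set_le)
qed

text \<open>The \<open>LEAST\<close> is attained once some proper colouring exists; giving every
  vertex its own colour is one, as arcs join distinct vertices.\<close>

lemma proper_coloring_chromatic_number:
  assumes "finite (verts G)" "\<And>u v. u \<rightarrow>\<^bsub>G\<^esub> v \<Longrightarrow> u \<in> verts G \<and> v \<in> verts G \<and> u \<noteq> v"
  shows "\<exists>c. proper_coloring G (chromatic_number G) c"
proof -
  obtain c where c: "bij_betw c (verts G) {0..<card (verts G)}"
    using ex_bij_betw_finite_nat[OF assms(1)] by blast
  have "proper_coloring G (card (verts G)) c"
    unfolding proper_coloring_def
  proof (intro conjI allI impI)
    show "c ` verts G \<subseteq> {..<card (verts G)}"
      using c by (simp add: bij_betw_def lessThan_atLeast0)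
    show "c u \<noteq> c v" if "u \<rightarrow>\<^bsub>G\<^esub> v" for u v
      using assms(2)[OF that] bij_betw_imp_inj_on[OF c] by (metis inj_onD)
  qed
  then show ?thesis
    unfolding chromatic_number_def
    by (intro LeastI[of "\<lambda>n. \<exists>c. proper_coloring G n c"] exI)
qed

text \<open>The \<open>n\<close> colour classes cover the vertices, and each class is a stable
  set.\<close>

lemma card_verts_le_coloring:
  assumes "finite (verts G)" "proper_coloring G n c"
  shows "card (verts G) \<le> n * stability_number G"
proof -
  have "verts G = (\<Union>i<n. {v \<in> verts G. c v = i})"
    using assms(2) by (auto simp: proper_coloring_def)
  then have "card (verts G) \<le> (\<Sum>i<n. card {v \<in> verts G. c v = i})"
    by (metis card_UN_le finite_lessThan)
  also have "\<dots> \<le> (\<Sum>i<n. stability_number G)"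
    using assms
    by (intro sum_mono card_stable_set_le)
       (simp_all add: stable_set_def pairwise_def proper_coloring_def, metis)
  finally show ?thesis
    by simp
qed

text \<open>For stable \<open>S\<close>, these are the vertices whose addition to \<open>S\<close>
  gives a larger stable set. Arcs are excluded in both directions, so this holds in any loop-free or
  looped digraph.\<close>

definition non_neighbours :: "('a, 'b) pre_digraph \<Rightarrow> 'a set \<Rightarrow> 'a set" where
  "non_neighbours G S = {v \<in> verts G - S. \<forall>u\<in>S. \<not> u \<rightarrow>\<^bsub>G\<^esub> v \<and> \<not> v \<rightarrow>\<^bsub>G\<^esub> u}"

text \<open>A stable set \<open>T\<close> among the non-neighbours is disjoint from
  \<open>S\<close>, and \<open>S \<union> T\<close> is stable in \<open>G\<close>.\<close>

lemma stability_number_non_neighbours_le: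
  assumes "finite (verts G)" "stable_set G S"
  shows "stability_number (G \<restriction> non_neighbours G S) \<le> stability_number G - card S"
proof (rule stability_number_le)
  show "finite (verts (G \<restriction> non_neighbours G S))"
    using assms(1) by (simp add: non_neighbours_def)
  fix T assume T: "stable_set (G \<restriction> non_neighbours G S) T"
  then have sub: "T \<subseteq> non_neighbours G S"
    by (simp add: stable_set_def)
  have "stable_set G (S \<union> T)"
    using T assms(2) sub unfolding stable_set_def pairwise_def
    by (simp add: non_neighbours_def subset_iff) blast
  then have "card (S \<union> T) \<le> stability_number G"
    using assms(1) by (rule card_stable_set_le[rotated])
  moreover have "finite (S \<union> T)" "S \<inter> T = {}"
    using assms sub by (auto simp: stable_set_def non_neighbours_def intro: finite_subset)
  ultimately show "card T \<le> stability_number G - card S"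
    by (simp add: card_Un_disjoint)
qed

lemma perfect_card_non_neighbours_le:
  assumes "graph G" "perfect G" "stable_set G S"
  shows "card (non_neighbours G S) \<le> clique_number G * (stability_number G - card S)"
proof -
  interpret graph G by fact
  define H where "H = G \<restriction> non_neighbours G S"
  have sub: "non_neighbours G S \<subseteq> verts G"
    by (auto simp: non_neighbours_def)
  then have fin: "finite (verts H)"
    by (auto simp: H_def intro: finite_subset)
  have "induced_subgraph H G"
    unfolding H_def using sub by (rule induced_induce)
  \<comment> \<open>Perfection enters here, applied to the induced subgraph
    \<open>H\<close>.\<close>
  then have \<chi>: "chromatic_number H = clique_number H"
    using assms(2) by (simp add: perfect_def)
  have "\<exists>c. proper_coloring H (chromatic_number H) c"
    using fin by (rule proper_coloring_chromatic_number) (use sub adj_not_same in \<open>auto simp: H_def\<close>)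
  then have "card (verts H) \<le> clique_number H * stability_number H"
    using card_verts_le_coloring[OF fin] \<chi> by auto
  also have "\<dots> \<le> clique_number G * (stability_number G - card S)"
    unfolding H_def using sub assms(3)
    by (intro mult_le_mono clique_number_induce_subgraph_le stability_number_non_neighbours_le) auto
  finally show ?thesis
    by (simp add: H_def)
qed

text \<open>Each such \<open>T\<close> is \<open>insert v S\<close> for a non-neighbour
  \<open>v\<close>, so \<open>v \<mapsto> insert v S\<close> maps the non-neighbours onto a superset
  of this family.\<close>

lemma card_stable_supersets_le:
  assumes "finite (verts G)" "stable_set G S"
  shows "card {T. (stable_set G T \<and> card T = Suc (card S)) \<and> S \<subseteq> T} \<le> card (non_neighbours G S)"
proof -
  have "T \<in> (\<lambda>v. insert v S) ` non_neighbours G S"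
    if T: "stable_set G T" "card T = Suc (card S)" "S \<subseteq> T" for T
  proof -
    have "card (T - S) = 1"
      using T assms(2) finite_subset[OF _ assms(1)] by (simp add: card_Diff_subset stable_set_def)
    then obtain v where v: "T - S = {v}"
      using card_1_singletonE by blast
    then have "v \<in> T" "v \<notin> S"
      by auto
    then have "v \<in> non_neighbours G S"
      using T unfolding non_neighbours_def stable_set_def pairwise_def by (simp add: subset_iff) metis
    with v T(3) show ?thesis
      by blast
  qed
  then have "{T. (stable_set G T \<and> card T = Suc (card S)) \<and> S \<subseteq> T}
      \<subseteq> (\<lambda>v. insert v S) ` non_neighbours G S"
    by auto
  moreover have "finite (non_neighbours G S)"
    using assms(1) by (simp add: non_neighbours_def)
  ultimately show ?thesis
    by (rule surj_card_le[rotated])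
qed

lemma num_stable_sets_Suc_le:
  assumes fin: "finite (verts G)"
    and ext: "\<And>S. stable_set G S \<Longrightarrow> card S = k \<Longrightarrow> card (non_neighbours G S) \<le> d"
  shows "Suc k * num_stable_sets G (Suc k) \<le> d * num_stable_sets G k"
proof -
  define \<A> where "\<A> j = {S. stable_set G S \<and> card S = j}" for j
  have fin\<A>: "finite (\<A> j)" for j
    using finite_stable_sets[OF fin] by (simp add: \<A>_def)
  have "card {S \<in> \<A> k. S \<subseteq> T} = Suc k" if T: "T \<in> \<A> (Suc k)" for T
  proof -
    \<comment> \<open>Stability passes to subsets, so all \<open>Suc k choose k = Suc k\<close>
      subsets of size \<open>k\<close> count.\<close>
    have "{S \<in> \<A> k. S \<subseteq> T} = {S. S \<subseteq> T \<and> card S = k}"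
      using T by (auto simp: \<A>_def intro: stable_set_subset)
    moreover have "finite T"
      using T by (intro card_ge_0_finite) (simp add: \<A>_def)
    ultimately show ?thesis
      using T n_subsets[of T k] by (simp add: \<A>_def)
  qed
  \<comment> \<open>Double counting of the inclusion pairs: the constant count per \<open>T\<close>
    is exchanged for a sum over \<open>S\<close>.\<close>
  then have "Suc k * card (\<A> (Suc k)) = (\<Sum>S\<in>\<A> k. card {T \<in> \<A> (Suc k). S \<subseteq> T})"
    using fin\<A> by (intro sum_multicount[symmetric]) auto
  also have "\<dots> \<le> (\<Sum>S\<in>\<A> k. d)"
  proof (rule sum_mono)
    fix S assume "S \<in> \<A> k"
    then show "card {T \<in> \<A> (Suc k). S \<subseteq> T} \<le> d"
      using card_stable_supersets_le[OF fin, of S] ext[of S] by (auto simp: \<A>_def)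
  qed
  finally show ?thesis
    by (simp add: \<A>_def num_stable_sets_def mult.commute)
qed

theorem proposition2p6:
  fixes G :: "('a, 'b) pre_digraph" and \<alpha> \<omega> k :: nat
  assumes "graph G" and "perfect G"
    and "\<alpha> = stability_number G" and "\<omega> = clique_number G"
    and "\<lceil>(real \<omega> * real \<alpha> - 1) / (real \<omega> + 1)\<rceil> \<le> int k" and "k < \<alpha>"
  shows "num_stable_sets G k \<ge> num_stable_sets G (k + 1)"
proof -
  interpret graph G by fact
  have "(real \<omega> * real \<alpha> - 1) / (real \<omega> + 1) \<le> real k"
    using assms(5) by (simp add: ceiling_le_iff)
  then have "real \<omega> * real \<alpha> - 1 \<le> real k * (real \<omega> + 1)"
    by (simp add: pos_divide_le_eq)
  \<comment> \<open>Rearranges \<open>\<omega> \<alpha> - 1 \<le> k \<omega> + k\<close>; as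
    \<open>k < \<alpha>\<close>, the natural subtraction does not truncate.\<close>
  then have "real (\<omega> * (\<alpha> - k)) \<le> real (Suc k)"
    using \<open>k < \<alpha>\<close> by (simp add: algebra_simps)
  then have d: "\<omega> * (\<alpha> - k) \<le> Suc k"
    by (simp only: of_nat_le_iff)
  have "Suc k * num_stable_sets G (Suc k) \<le> \<omega> * (\<alpha> - k) * num_stable_sets G k"
    using perfect_card_non_neighbours_le[OF assms(1,2)] assms(3,4)
    by (intro num_stable_sets_Suc_le) auto
  also have "\<dots> \<le> Suc k * num_stable_sets G k"
    using d by (rule mult_le_mono1)
  finally have "num_stable_sets G (Suc k) \<le> num_stable_sets G k"
    by (simp only: Suc_mult_le_cancel1)
  then show ?thesis
    by simp
qed

end
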